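(* Let $\mathcal X:y^n=f(x)$, $m$, $\lambda$, $H_m$ be as in the context, with $H_m$ acting transitively on $\mathcal Y$. Let $s\ge1$ and write $-T_s=\{(-a,-b):(a,b)\in T_s\}\subseteq\mathbb Z_m\times\mathbb Z_n$. Then $$\operatorname{Hull}(\mathcal C_s)=\bigoplus_{\chi\in T_s\setminus(-T_s)}(\mathbb F_q^N)_\chi,\qquad\dim\operatorname{Hull}(\mathcal C_s)=|T_s|-|T_s\cap(-T_s)|.$$ In particular $\mathcal C_s$ is LCD if and only if $T_s=-T_s$, and self-orthogonal if and only if $T_s\cap(-T_s)=\emptyset$.
   Context: Setting. $q$ is a power of a prime $p$; $n\ge2$, $d\ge3$ are integers with $n\mid q-1$; $c=\gcd(n,d)$; $f=\sum a_ix^i\in\mathbb F_q[x]$ is separable of degree $d$ with no root in $\mathbb F_q$; $\mathcal X$ is the smooth projective model of $y^n=f(x)$ over $\mathbb F_q$. $\mathcal Y$ is the set of all $\mathbb F_q$-rational points of $\mathcal X$ over $\mathbb A^1(\mathbb F_q)$, $N=|\mathcal Y|$. For $s\ge1$, $\mathcal C_s\subseteq\mathbb F_q^N$ is the span of the vectors $(x(P)^iy(P)^j)_{P\in\mathcal Y}$ with $x^iy^j\in B_s=\{x^iy^j:i\ge0,\ 0\le j\le n-1,\ \frac nc i+\frac dc j\le s\}$; this is the algebraic geometry code $C_L(D,sD_\infty)$, $D=\sum_{P\in\mathcal Y}P$, $D_\infty$ the reduced divisor of points over $x=\infty$. $C^\perp$ is the dual for the standard bilinear form, $\operatorname{Hull}(C)=C\cap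 C^\perp$, $C$ is LCD if $\operatorname{Hull}(C)=0$ and self-orthogonal if $C\subseteq C^\perp$. Transitive stratum. Let $m$ be a positive integer dividing $m(f)=\gcd(q-1,\{i:a_i\ne0\})$, let $\lambda\in\mathbb F_q^*$ have order $m$, let $\zeta_n\in\mathbb F_q$ be a primitive $n$-th root of unity, write $f(x)=g(x^m)$ with $g\in\mathbb F_q[u]$ of degree $d/m$, and assume $g(0)\notin(\mathbb F_q^* )^n$. Let $\tau(x,y)=(x,\zeta_ny)$, $\sigma_\lambda(x,y)=(\lambda x,y)$ and $H_m=\langle\tau,\sigma_\lambda\rangle\cong\mathbb Z_n\times\mathbb Z_m$, which acts freely on $\mathcal Y$. Assume that $H_m$ acts transitively, hence regularly, on $\mathcal Y$ (equivalently $N=nm$; equivalently exactly one of the $(q-1)/m$ values $g(w^m)$, $w$ running through representatives of $\mathbb F_q^*/\langle\lambda\rangle$, lies in $(\mathbb F_q^* )^n$). Characters. The characters of $H_m$ are identified with $\mathbb Z_m\times\mathbb Z_n$: $(\alpha,\beta)$ is the character of the monomials $x^iy^j$ with $i\equiv\alpha\pmod m$, $j\equiv\beta\pmod n$, and $(\mathbb F_q^N)_{(\alpha,\beta)}=\{v\in\mathbb F_q^{\mathcal Y}:v_{\sigma_\lambda(P)}=\lambda^\alpha v_P,\ v_{\tau(P)}=\zeta_n^\beta v_P\ \forall P\in\mathcal Y\}$, a line in the regular representation $\mathbb F_q^N$. The defining set of $\mathcal C_s$ is $T_s=\{(i\bmod m,\ j\bmod n):x^iy^j\in B_s\}\subseteq\mathbb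 Z_m\times\mathbb Z_n$. *)

theory Defs
  imports
    "HOL-Algebra.Group_Action"
    "HOL-Algebra.Elementary_Groups"
    "HOL-Library.Function_Algebras"
    "HOL-Computational_Algebra.Polynomial"
    "HOL-Library.Cardinality"
begin

text \<open>
  The ground field \<open>\<F>\<^sub>q\<close> is a type of sorts \<open>field\<close> and \<open>finite\<close>, with \<open>q = CARD('a)\<close>.
  For a finite set \<open>Y\<close> of coordinate positions, \<open>\<F>\<^sub>q\<^sup>Y\<close> is the set of functions
  that are zero off \<open>Y\<close>, so that all its subspaces live in one vector space of functions.
\<close>

definition vscale :: "'a::field \<Rightarrow> ('b \<Rightarrow> 'a) \<Rightarrow> 'b \<Rightarrow> 'a" where
  "vscale c v = (\<lambda>P. c * v P)"

interpretation fspace: vector_space "vscale :: 'a::field \<Rightarrow> ('b \<Rightarrow> 'a) \<Rightarrow> 'b \<Rightarrow> 'a"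
  by standard (auto simp: vscale_def fun_eq_iff algebra_simps)

definition ambient :: "'b set \<Rightarrow> ('b \<Rightarrow> 'a::field) set" where
  "ambient Y = {v. \<forall>P. P \<notin> Y \<longrightarrow> v P = 0}"

definition dual_code :: "'b set \<Rightarrow> ('b \<Rightarrow> 'a::field) set \<Rightarrow> ('b \<Rightarrow> 'a) set" where
  "dual_code Y C = {w \<in> ambient Y. \<forall>v\<in>C. (\<Sum>P\<in>Y. v P * w P) = 0}"

definition code_hull :: "'b set \<Rightarrow> ('b \<Rightarrow> 'a::field) set \<Rightarrow> ('b \<Rightarrow> 'a) set" where
  "code_hull Y C = C \<inter> dual_code Y C"

definition is_LCD :: "'b set \<Rightarrow> ('b \<Rightarrow> 'a::field) set \<Rightarrow> bool" where
  "is_LCD Y C \<longleftrightarrow> code_hull Y C = {0}"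

definition self_orthogonal :: "'b set \<Rightarrow> ('b \<Rightarrow> 'a::field) set \<Rightarrow> bool" where
  "self_orthogonal Y C \<longleftrightarrow> C \<subseteq> dual_code Y C"

text \<open>
  \<open>W\<close> is the internal direct sum of the subspaces \<open>V i\<close>, \<open>i \<in> I\<close>: summation is a
  bijection from the (external) product of the \<open>V i\<close> onto \<open>W\<close>. The empty direct sum is \<open>{0}\<close>.
\<close>

definition internal_direct_sum ::
    "('b \<Rightarrow> 'a::field) set \<Rightarrow> 'i set \<Rightarrow> ('i \<Rightarrow> ('b \<Rightarrow> 'a) set) \<Rightarrow> bool" where
  "internal_direct_sum W I V \<longleftrightarrow>
     finite I \<and> (\<forall>i\<in>I. fspace.subspace (V i)) \<and>
     bij_betw (\<lambda>u. \<Sum>i\<in>I. u i) (\<Pi>\<^sub>E i\<in>I. V i) W"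

definition separable :: "'a::field poly \<Rightarrow> bool" where
  "separable f \<longleftrightarrow> coprime f (pderiv f)"

text \<open>\<open>has_order x k\<close>: \<open>x\<close> has multiplicative order \<open>k\<close>, i.e. is a primitive \<open>k\<close>-th root of unity.\<close>

definition has_order :: "'a::field \<Rightarrow> nat \<Rightarrow> bool" where
  "has_order x k \<longleftrightarrow> 0 < k \<and> x ^ k = 1 \<and> (\<forall>j. 0 < j \<and> j < k \<longrightarrow> x ^ j \<noteq> 1)"

definition exponent_gcd :: "'a::{field,finite} poly \<Rightarrow> nat" where
  "exponent_gcd f = Gcd (insert (CARD('a) - 1) {i. coeff f i \<noteq> 0})"

text \<open>
  The rational points over the affine line of the smooth projective model of
  \<open>y\<^sup>n = f(x)\<close>. For \<open>f\<close> separable and \<open>n\<close> dividing \<open>q - 1\<close> the plane affine curve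
  is already smooth, hence it is the part of the model over the affine line, and these points
  are the solutions in \<open>\<F>\<^sub>q\<^sup>2\<close>. The lemma \<open>finite_points_nonsingular\<close> below is
  the Jacobian criterion at the rational points.
\<close>

definition finite_points :: "nat \<Rightarrow> 'a::{field,finite} poly \<Rightarrow> ('a \<times> 'a) set" where
  "finite_points n f = {(x, y). y ^ n = poly f x}"

lemma finite_points_nonsingular:
  fixes f :: "'a::{field,finite} poly"
  assumes "n dvd CARD('a) - 1" "separable f" "(x, y) \<in> finite_points n f"
  shows "of_nat n * y ^ (n - 1) \<noteq> 0 \<or> poly (pderiv f) x \<noteq> 0"
proof (rule ccontr)
  assume sing: "\<not> ?thesis"
  have "of_nat (CARD('a) - 1) + 1 = (of_nat CARD('a) :: 'a)"
    by (simp add: of_nat_diff Suc_leI)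
  also have "(of_nat CARD('a) :: 'a) = 0"
  proof -
    have "(\<Sum>t\<in>UNIV. t + 1 :: 'a) = (\<Sum>t\<in>UNIV. t)"
      by (rule sum.reindex_bij_witness[of _ "\<lambda>t. t - 1" "\<lambda>t. t + 1"]) auto
    then show ?thesis by (simp add: sum.distrib)
  qed
  finally have "of_nat (CARD('a) - 1) \<noteq> (0 :: 'a)" by auto
  then have n: "of_nat n \<noteq> (0 :: 'a)"
    using assms(1) by (metis dvdE mult_zero_left of_nat_mult)
  then have "n \<noteq> 0" by (intro notI) simp
  then have "poly f x = 0"
    using sing n assms(3) by (cases n) (auto simp: finite_points_def)
  moreover have "poly (pderiv f) x = 0" using sing by simp
  ultimately have "is_unit [:- x, 1:]"
    using assms(2) unfolding separable_def
    by (intro coprime_common_divisor[of f "pderiv f"]) (auto simp: poly_eq_0_iff_dvd)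
  then show False by (simp add: is_unit_iff_degree)
qed

text \<open>Exponents \<open>(i, j)\<close> of the monomials in \<open>B\<^sub>s\<close>; both divisions by \<open>c = gcd n d\<close> are exact.\<close>

definition Bset :: "nat \<Rightarrow> nat \<Rightarrow> nat \<Rightarrow> (nat \<times> nat) set" where
  "Bset n d s = {(i, j). j \<le> n - 1 \<and> (n div gcd n d) * i + (d div gcd n d) * j \<le> s}"

definition eval_vec :: "('a \<times> 'a) set \<Rightarrow> nat \<times> nat \<Rightarrow> 'a \<times> 'a \<Rightarrow> 'a::field" where
  "eval_vec Y = (\<lambda>(i, j) P. if P \<in> Y then fst P ^ i * snd P ^ j else 0)"

definition AG_code :: "nat \<Rightarrow> 'a::{field,finite} poly \<Rightarrow> nat \<Rightarrow> ('a \<times> 'a \<Rightarrow> 'a) set" where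
  "AG_code n f s = fspace.span (eval_vec (finite_points n f) ` Bset n (degree f) s)"

definition tau :: "'a::field \<Rightarrow> 'a \<times> 'a \<Rightarrow> 'a \<times> 'a" where
  "tau z = (\<lambda>(x, y). (x, z * y))"

definition sigma :: "'a::field \<Rightarrow> 'a \<times> 'a \<Rightarrow> 'a \<times> 'a" where
  "sigma l = (\<lambda>(x, y). (l * x, y))"

definition Hgroup :: "'a::field \<Rightarrow> 'a \<Rightarrow> ('a \<times> 'a \<Rightarrow> 'a \<times> 'a) monoid" where
  "Hgroup z l = subgroup_generated (BijGroup UNIV) {tau z, sigma l}"

text \<open>
  Transitivity on the points; a transitive action is on a nonempty set. Under the hypotheses of the
  theorem the \<open>group_action\<close> part of \<open>transitive_action\<close> holds, see \<open>Hgroup_action\<close> below.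
\<close>

definition acts_transitively :: "'a::field \<Rightarrow> 'a \<Rightarrow> ('a \<times> 'a) set \<Rightarrow> bool" where
  "acts_transitively z l Y \<longleftrightarrow>
     Y \<noteq> {} \<and> transitive_action (Hgroup z l) Y (\<lambda>h. restrict h Y)"

text \<open>The character group \<open>\<int>\<^sub>m \<times> \<int>\<^sub>n\<close>, on canonical representatives in \<open>int\<close>.\<close>

definition char_group :: "nat \<Rightarrow> nat \<Rightarrow> (int \<times> int) monoid" where
  "char_group m n = integer_mod_group m \<times>\<times> integer_mod_group n"

definition eigenline ::
    "('a \<times> 'a) set \<Rightarrow> 'a \<Rightarrow> 'a \<Rightarrow> int \<times> int \<Rightarrow> ('a \<times> 'a \<Rightarrow> 'a::field) set" where
  "eigenline Y z l = (\<lambda>(a, b). {v \<in> ambient Y.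
     \<forall>P\<in>Y. v (sigma l P) = l powi a * v P \<and> v (tau z P) = z powi b * v P})"

definition defining_set :: "nat \<Rightarrow> nat \<Rightarrow> nat \<Rightarrow> nat \<Rightarrow> (int \<times> int) set" where
  "defining_set m n d s = (\<lambda>(i, j). (int i mod int m, int j mod int n)) ` Bset n d s"

definition neg_set :: "nat \<Rightarrow> nat \<Rightarrow> (int \<times> int) set \<Rightarrow> (int \<times> int) set" where
  "neg_set m n T = set_inv\<^bsub>char_group m n\<^esub> T"

lemma neg_set_eq:
  assumes "0 < m" "0 < n" "T \<subseteq> carrier (char_group m n)"
  shows "neg_set m n T = {((- a) mod int m, (- b) mod int n) | a b. (a, b) \<in> T}"
proof -
  have "inv\<^bsub>char_group m n\<^esub> (a, b) = ((- a) mod int m, (- b) mod int n)" if "(a, b) \<in> T" for a b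
    using that assms unfolding char_group_def by (auto simp: DirProd_def[symmetric] subset_iff)
  then show ?thesis unfolding neg_set_def SET_INV_def by force
qed

lemma Hgroup_action:
  fixes f g :: "'a::{field,finite} poly"
  assumes z: "has_order z n" and l: "has_order l m" and f: "f = pcompose g (monom 1 m)"
  shows "group_action (Hgroup z l) (finite_points n f) (\<lambda>h. restrict h (finite_points n f))"
proof -
  let ?B = "BijGroup (UNIV :: ('a \<times> 'a) set)" and ?Y = "finite_points n f"
  interpret B: group ?B by (rule group_BijGroup)
  have mult: "h \<otimes>\<^bsub>?B\<^esub> k = h \<circ> k" if "h \<in> carrier ?B" "k \<in> carrier ?B" for h k
    using that by (auto simp: BijGroup_def compose_def fun_eq_iff)
  have carrier: "h \<in> carrier ?B \<longleftrightarrow> bij h" for h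
    by (auto simp: BijGroup_def Bij_def)
  have nz: "z \<noteq> 0" "l \<noteq> 0"
    using z l by (auto simp: has_order_def power_0_left split: if_splits)
  have gens: "{tau z, sigma l} \<subseteq> carrier ?B"
  proof -
    have "bij (tau z)"
      by (rule o_bij[of "tau (inverse z)"]) (auto simp: tau_def fun_eq_iff nz)
    moreover have "bij (sigma l)"
      by (rule o_bij[of "sigma (inverse l)"]) (auto simp: sigma_def fun_eq_iff nz)
    ultimately show ?thesis by (simp add: carrier)
  qed
  have bij_Y: "bij_betw h ?Y ?Y" if "bij h" "h ` ?Y \<subseteq> ?Y" for h
  proof -
    have "inj_on h ?Y" using that(1) bij_is_inj inj_on_subset by blast
    then show ?thesis using endo_inj_surj[OF _ that(2)] by (simp add: bij_betw_def)
  qed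
  have gen_Y: "bij_betw h ?Y ?Y" if "h \<in> {tau z, sigma l}" for h
  proof (rule bij_Y)
    show "bij h" using that gens carrier by blast
    show "h ` ?Y \<subseteq> ?Y"
      using that z l
      by (auto simp: finite_points_def tau_def sigma_def f has_order_def power_mult_distrib
          poly_pcompose poly_monom)
  qed
  have inv: "inv\<^bsub>?B\<^esub> h = inv_into UNIV h" if "bij h" for h
    using inv_BijGroup[of h UNIV] that by (simp add: Bij_def restrict_UNIV)
  have Y: "bij_betw h ?Y ?Y" if "h \<in> generate ?B {tau z, sigma l}" for h
    using that
  proof induction
    case one then show ?case by (simp add: BijGroup_def bij_betw_def)
  next
    case (incl h) then show ?case by (rule gen_Y)
  next
    case (inv h)
    have h: "bij h" "bij_betw h ?Y ?Y" using inv gens carrier gen_Y by blast+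
    have "inv_into UNIV h ` ?Y = ?Y"
      using h by (metis bij_betw_def bij_is_inj image_inv_f_f)
    then have "bij_betw (inv_into UNIV h) ?Y ?Y"
      by (intro bij_Y bij_imp_bij_inv h(1)) simp
    then show ?case using \<open>bij h\<close> \<open>\<And>h. bij h \<Longrightarrow> inv\<^bsub>?B\<^esub> h = inv_into UNIV h\<close> by simp
  next
    case (eng h k)
    then have "h \<otimes>\<^bsub>?B\<^esub> k = h \<circ> k"
      using B.generate_in_carrier[OF gens] mult by blast
    then show ?case using eng bij_betw_trans by metis
  qed
  have car: "carrier (Hgroup z l) = generate ?B {tau z, sigma l}"
    using gens by (simp add: Hgroup_def subgroup_generated_def Int_absorb1)
  have multH: "h \<otimes>\<^bsub>Hgroup z l\<^esub> k = h \<circ> k"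
    if "h \<in> carrier (Hgroup z l)" "k \<in> carrier (Hgroup z l)" for h k
    using that mult B.generate_in_carrier[OF gens] unfolding car
    by (simp add: Hgroup_def)
  show ?thesis
    unfolding group_action_def group_hom_def group_hom_axioms_def
  proof (intro conjI homI)
    show "group (Hgroup z l)" by (simp add: Hgroup_def)
    show "group (BijGroup ?Y)" by (rule group_BijGroup)
    fix h assume h: "h \<in> carrier (Hgroup z l)"
    show hY: "restrict h ?Y \<in> carrier (BijGroup ?Y)"
      using Y[of h] h car by (auto simp: BijGroup_def Bij_def)
    fix k assume k: "k \<in> carrier (Hgroup z l)"
    have "restrict k ?Y \<in> carrier (BijGroup ?Y)"
      using Y[of k] k car by (auto simp: BijGroup_def Bij_def)
    moreover have "k ` ?Y = ?Y" using Y[of k] k car by (auto simp: bij_betw_def)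
    ultimately show "restrict (h \<otimes>\<^bsub>Hgroup z l\<^esub> k) ?Y
        = restrict h ?Y \<otimes>\<^bsub>BijGroup ?Y\<^esub> restrict k ?Y"
      using hY multH[OF h k] by (auto simp: BijGroup_def compose_def fun_eq_iff)
  qed
qed

end

theory Submission
  imports Defs
begin

text \<open>
  The code is spanned by joint eigenvectors of a regular abelian group action, and on such
  eigenvectors the standard bilinear form is a permutation matrix up to nonzero scalars; the hull
  of such a span can be read off combinatorially.

  Fix a rational point \<open>(x0, y0)\<close>. Its second coordinate is nonzero because \<open>f\<close> has no root, and its
  first coordinate is nonzero because otherwise \<open>g(0) = y0\<^sup>n\<close> would be the \<open>n\<close>-th power of a nonzero element. By transitivity
  the points are exactly \<open>(\<lambda>\<^sup>i x0, \<zeta>\<^sup>j y0)\<close> with \<open>i < m\<close>, \<open>j < n\<close> (\<open>regular_orbit_if_transitive\<close>).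
  Hence \<open>x\<^sup>m\<close> and \<open>y\<^sup>n\<close> are nonzero constants on the points, so that up to a nonzero scalar the
  evaluation of a monomial depends only on its exponents modulo \<open>(m, n)\<close>, that is, on its
  character. The code is therefore the span of the vectors \<open>e\<^sub>\<chi>\<close> with \<open>\<chi>\<close> in the defining set
  (\<open>span_eval_vec\<close>), and each eigenspace is the line through \<open>e\<^sub>\<chi>\<close> (\<open>eigenline_eq\<close>).

  The inner product of \<open>e\<^sub>\<chi>\<close> and \<open>e\<^sub>\<psi>\<close> is the sum of a monomial with character \<open>\<chi> + \<psi>\<close> over the
  points. Moving the points by the group multiplies this sum by the values of \<open>\<chi> + \<psi>\<close>, so it vanishes
  unless \<open>\<psi> = -\<chi>\<close>; in that case it is \<open>mn\<close> times a nonzero constant, and \<open>mn\<close> is invertible in the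
  field since \<open>m\<close> and \<open>n\<close> divide \<open>q - 1\<close> (\<open>monomial_sum_eq_0_iff\<close>).

  The rest is linear algebra in the locale \<open>paired_family\<close>: pairing a vector of the code with
  \<open>e\<^bsub>-\<chi>\<^esub>\<close> reads off its coefficient at \<open>\<chi>\<close>, so it lies in the dual if and only if its coefficients
  at all \<open>\<chi>\<close> with \<open>-\<chi>\<close> in the defining set vanish (\<open>hull_span\<close>).
\<close>

section \<open>Codes spanned by vectors with a monomial Gram matrix\<close>

definition pairing :: "'b set \<Rightarrow> ('b \<Rightarrow> 'a::field) \<Rightarrow> ('b \<Rightarrow> 'a) \<Rightarrow> 'a" where
  "pairing Y v w = (\<Sum>P\<in>Y. v P * w P)"

lemma pairing_commute: "pairing Y v w = pairing Y w v"
  by (simp add: pairing_def mult.commute)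

lemma pairing_0_left: "pairing Y 0 w = 0"
  by (simp add: pairing_def)

lemma pairing_add_left: "pairing Y (u + v) w = pairing Y u w + pairing Y v w"
  by (simp add: pairing_def distrib_right sum.distrib)

lemma pairing_scale_left: "pairing Y (vscale c v) w = c * pairing Y v w"
  by (simp add: pairing_def vscale_def sum_distrib_left mult.assoc)

lemma pairing_sum_left: "pairing Y (\<Sum>i\<in>I. v i) w = (\<Sum>i\<in>I. pairing Y (v i) w)"
  by (induction I rule: infinite_finite_induct) (simp_all add: pairing_0_left pairing_add_left del: zero_fun_apply plus_fun_apply)

lemma subspace_ambient: "fspace.subspace (ambient Y)"
  by (auto simp: fspace.subspace_def ambient_def vscale_def)

lemma dual_code_span:
  "dual_code Y (fspace.span S) = {w \<in> ambient Y. \<forall>v\<in>S. pairing Y v w = 0}"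
proof -
  have "pairing Y v w = 0" if "v \<in> fspace.span S" "\<forall>v\<in>S. pairing Y v w = 0" for v w
    using that(1)
    by (induction rule: fspace.span_induct_alt)
       (simp_all only: pairing_0_left pairing_add_left pairing_scale_left that(2) mult_zero_right add_0_left)
  then show ?thesis
    by (auto simp: dual_code_def pairing_def[symmetric] fspace.span_base)
qed

text \<open>
  The Gram matrix of the family \<open>e\<close> is monomial, with permutation the involution \<open>\<nu>\<close>. Thus
  the vectors \<open>e (\<nu> k)\<close> are, up to scalars, dual to the vectors \<open>e k\<close>. In the application \<open>\<nu>\<close> is the
  inversion of characters.
\<close>

locale paired_family =
  fixes Y :: "'b set" and K :: "'i set" and \<nu> :: "'i \<Rightarrow> 'i" and e :: "'i \<Rightarrow> 'b \<Rightarrow> 'a::field"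
  assumes finite_K: "finite K"
    and ambient_e: "k \<in> K \<Longrightarrow> e k \<in> ambient Y"
    and invol_in: "k \<in> K \<Longrightarrow> \<nu> k \<in> K"
    and invol: "k \<in> K \<Longrightarrow> \<nu> (\<nu> k) = k"
    and pairing_eq_0: "k \<in> K \<Longrightarrow> l \<in> K \<Longrightarrow> pairing Y (e k) (e l) = 0 \<longleftrightarrow> l \<noteq> \<nu> k"
begin

abbreviation comb :: "('i \<Rightarrow> 'a) \<Rightarrow> 'i set \<Rightarrow> 'b \<Rightarrow> 'a" where
  "comb c I \<equiv> \<Sum>k\<in>I. vscale (c k) (e k)"

lemma invol_eq_iff: "k \<in> K \<Longrightarrow> l \<in> K \<Longrightarrow> \<nu> k = \<nu> l \<longleftrightarrow> k = l"
  by (metis invol)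

text \<open>
  Pairing with \<open>e (\<nu> l)\<close> extracts the coefficient at \<open>l\<close>; independence of the family and the
  description of the hull both come from this.
\<close>

lemma pairing_comb:
  assumes "I \<subseteq> K" "l \<in> K"
  shows "pairing Y (comb c I) (e (\<nu> l)) =
    (if l \<in> I then c l * pairing Y (e l) (e (\<nu> l)) else 0)"
proof -
  have "pairing Y (comb c I) (e (\<nu> l)) = (\<Sum>k\<in>I. c k * pairing Y (e k) (e (\<nu> l)))"
    by (simp add: pairing_sum_left pairing_scale_left)
  also have "\<dots> = (\<Sum>k\<in>I. if k = l then c l * pairing Y (e l) (e (\<nu> l)) else 0)"
    using assms by (intro sum.cong) (auto simp: pairing_eq_0 invol_in invol_eq_iff)
  also have "\<dots> = (if l \<in> I then c l * pairing Y (e l) (e (\<nu> l)) else 0)"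
    using assms finite_K by (simp add: sum.delta finite_subset)
  finally show ?thesis .
qed

lemma pairing_invol_nonzero: "k \<in> K \<Longrightarrow> pairing Y (e k) (e (\<nu> k)) \<noteq> 0"
  by (simp add: pairing_eq_0 invol_in)

lemma e_nonzero: "k \<in> K \<Longrightarrow> e k \<noteq> 0"
  using pairing_invol_nonzero[of k] by (auto simp: pairing_0_left)

lemma comb_eq_coeff:
  assumes "I \<subseteq> K" "comb c I = comb c' I" "l \<in> I"
  shows "c l = c' l"
  using pairing_comb[of I l c] pairing_comb[of I l c'] assms pairing_invol_nonzero[of l] by auto

lemma inj_e: "inj_on e K"
  using pairing_eq_0 by (metis inj_onI invol invol_in)

lemma span_e:
  assumes "I \<subseteq> K"
  shows "fspace.span (e ` I) = range (\<lambda>c. comb c I)"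
proof -
  have inj: "inj_on e I" and fin: "finite (e ` I)"
    using assms inj_e finite_K inj_on_subset finite_subset by blast+
  have "fspace.span (e ` I) = range (\<lambda>u. comb (\<lambda>k. u (e k)) I)"
    by (simp add: fspace.span_finite[OF fin] sum.reindex[OF inj])
  also have "\<dots> = range (\<lambda>c. comb c I)"
  proof (intro subset_antisym image_subsetI)
    fix c
    have "comb c I = comb (\<lambda>k. (\<lambda>v. c (inv_into I e v)) (e k)) I"
      using inj by (intro sum.cong) auto
    then show "comb c I \<in> range (\<lambda>u. comb (\<lambda>k. u (e k)) I)" by (rule range_eqI[of _ _ "\<lambda>v. c (inv_into I e v)"])
  qed auto
  finally show ?thesis .
qed

lemma independent_e:
  assumes "I \<subseteq> K"
  shows "fspace.independent (e ` I)"
proof -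
  have inj: "inj_on e I" and fin: "finite (e ` I)"
    using assms inj_e finite_K inj_on_subset finite_subset by blast+
  have "u v = 0" if 0: "(\<Sum>v\<in>e ` I. vscale (u v) v) = 0" and v: "v \<in> e ` I" for u v
  proof -
    obtain l where l: "l \<in> I" "v = e l" using v by blast
    have "comb (\<lambda>k. u (e k)) I = comb (\<lambda>k. 0) I"
      using 0 by (simp add: sum.reindex[OF inj])
    from comb_eq_coeff[OF assms this l(1)] show ?thesis by (simp add: l)
  qed
  then show ?thesis
    using fspace.dependent_finite[OF fin] by blast
qed

text \<open>
  Membership in the dual is tested on the generators \<open>e l\<close> with \<open>l \<in> T\<close>, and the test against
  \<open>e l\<close> is the vanishing of the coefficient at \<open>\<nu> l\<close>. So exactly the coefficients on \<open>T \<inter> \<nu> ` T\<close>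
  have to vanish.
\<close>

lemma hull_span:
  assumes T: "T \<subseteq> K"
  shows "code_hull Y (fspace.span (e ` T)) = fspace.span (e ` (T - \<nu> ` T))"
    (is "?H = fspace.span (e ` ?I)")
proof (intro subset_antisym subsetI)
  fix v assume v: "v \<in> ?H"
  then obtain c where c: "v = comb c T"
    using span_e[OF T] by (auto simp: code_hull_def)
  have "c (\<nu> l) = 0" if l: "l \<in> T" "\<nu> l \<in> T" for l
  proof -
    have "pairing Y v (e l) = 0"
      using v l by (simp add: code_hull_def dual_code_span pairing_commute[of Y v])
    with pairing_comb[OF T, of "\<nu> l" c] T l pairing_invol_nonzero[of "\<nu> l"] show ?thesis
      by (auto simp: c invol subset_iff)
  qed
  then have "v = comb c ?I"
    unfolding c using T finite_K
    by (intro sum.mono_neutral_right) (auto intro: finite_subset simp: vscale_def zero_fun_def)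
  then show "v \<in> fspace.span (e ` ?I)"
    using T span_e[of ?I] by auto
next
  fix v assume v: "v \<in> fspace.span (e ` ?I)"
  have I: "?I \<subseteq> K" using T by blast
  obtain c where c: "v = comb c ?I" using v span_e[OF I] by auto
  have "v \<in> ambient Y"
    using v fspace.span_minimal[OF _ subspace_ambient, of "e ` ?I" Y] I ambient_e by blast
  moreover have "pairing Y (e k) v = 0" if k: "k \<in> T" for k
    using pairing_comb[OF I, of "\<nu> k" c] k T by (auto simp: c invol invol_in subset_iff pairing_commute[of Y "e k"])
  moreover have "v \<in> fspace.span (e ` T)"
    using v fspace.span_mono[of "e ` ?I" "e ` T"] by blast
  ultimately show "v \<in> ?H" by (simp add: code_hull_def dual_code_span)
qed

lemma dim_hull:
  assumes T: "T \<subseteq> K"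
  shows "int (fspace.dim (code_hull Y (fspace.span (e ` T)))) = int (card T) - int (card (T \<inter> \<nu> ` T))"
proof -
  have I: "T - \<nu> ` T \<subseteq> K" using T by blast
  have "fspace.dim (code_hull Y (fspace.span (e ` T))) = card (e ` (T - \<nu> ` T))"
    unfolding hull_span[OF T] by (rule fspace.dim_span_eq_card_independent[OF independent_e[OF I]])
  also have "\<dots> = card (T - \<nu> ` T)"
    using I inj_e by (intro card_image) (rule inj_on_subset)
  also have "\<dots> = card T - card (T \<inter> \<nu> ` T)"
    using T finite_K by (metis card_Diff_subset_Int finite_Int finite_subset)
  finally show ?thesis
    using T finite_K card_mono[of T "T \<inter> \<nu> ` T"] by (simp add: finite_subset of_nat_diff)
qed

text \<open>
  Choosing one vector on each line is choosing one coefficient for each index, so unique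
  decomposition is the uniqueness of coefficients in \<open>comb_eq_coeff\<close>.
\<close>

lemma direct_sum_lines:
  assumes I: "I \<subseteq> K" and V: "\<And>k. k \<in> I \<Longrightarrow> V k = range (\<lambda>c. vscale c (e k))"
  shows "internal_direct_sum (fspace.span (e ` I)) I V"
proof -
  have "V k = fspace.span {e k}" if "k \<in> I" for k
    using V[OF that] fspace.span_singleton[of "e k"] by auto
  moreover have "bij_betw (\<lambda>u. \<Sum>i\<in>I. u i) (Pi\<^sub>E I V) (fspace.span (e ` I))"
    unfolding bij_betw_def
  proof
    have coeffs: "\<exists>c. \<forall>k\<in>I. u k = vscale (c k) (e k)" if "u \<in> Pi\<^sub>E I V" for u
      using that V by (intro bchoice) (fastforce simp: PiE_iff)
    show "inj_on (\<lambda>u. \<Sum>i\<in>I. u i) (Pi\<^sub>E I V)"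
    proof (rule inj_onI)
      fix u u' assume u: "u \<in> Pi\<^sub>E I V" "u' \<in> Pi\<^sub>E I V" and eq: "(\<Sum>i\<in>I. u i) = (\<Sum>i\<in>I. u' i)"
      from coeffs[OF u(1)] coeffs[OF u(2)] obtain c c'
        where c: "\<And>k. k \<in> I \<Longrightarrow> u k = vscale (c k) (e k)"
          and c': "\<And>k. k \<in> I \<Longrightarrow> u' k = vscale (c' k) (e k)" by blast
      have "comb c I = comb c' I" using eq by (simp add: c c')
      then have "c k = c' k" if "k \<in> I" for k using comb_eq_coeff[OF I] that by blast
      then show "u = u'" using u by (intro PiE_ext[OF u]) (simp add: c c')
    qed
    show "(\<lambda>u. \<Sum>i\<in>I. u i) ` Pi\<^sub>E I V = fspace.span (e ` I)"
    proof (intro subset_antisym subsetI)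
      fix w assume "w \<in> (\<lambda>u. \<Sum>i\<in>I. u i) ` Pi\<^sub>E I V"
      then obtain u where u: "u \<in> Pi\<^sub>E I V" "w = (\<Sum>i\<in>I. u i)" by blast
      with coeffs[OF u(1)] obtain c where "\<And>k. k \<in> I \<Longrightarrow> u k = vscale (c k) (e k)" by blast
      then show "w \<in> fspace.span (e ` I)" using u by (auto simp: span_e[OF I])
    next
      fix w assume "w \<in> fspace.span (e ` I)"
      then obtain c where c: "w = comb c I" by (auto simp: span_e[OF I])
      let ?u = "restrict (\<lambda>k. vscale (c k) (e k)) I"
      have "?u \<in> Pi\<^sub>E I V" "w = (\<Sum>i\<in>I. ?u i)" using c V by auto
      then show "w \<in> (\<lambda>u. \<Sum>i\<in>I. u i) ` Pi\<^sub>E I V" by blast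
    qed
  qed
  ultimately show ?thesis
    using I finite_K finite_subset by (auto simp: internal_direct_sum_def)
qed

lemma is_LCD_span:
  assumes T: "T \<subseteq> K"
  shows "is_LCD Y (fspace.span (e ` T)) \<longleftrightarrow> T = \<nu> ` T"
proof
  assume "is_LCD Y (fspace.span (e ` T))"
  then have "e k = 0" if "k \<in> T - \<nu> ` T" for k
    using that fspace.span_base[of "e k" "e ` (T - \<nu> ` T)"] hull_span[OF T]
    by (auto simp: is_LCD_def)
  then have sub: "T \<subseteq> \<nu> ` T" using e_nonzero T by blast
  \<comment> \<open>The reverse inclusion follows by applying the involution.\<close>
  have "\<nu> k \<in> T" if "k \<in> T" for k using sub that T invol by (metis imageE subsetD)
  then show "T = \<nu> ` T" using sub by blast
next
  assume "T = \<nu> ` T"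
  then have empty: "T - \<nu> ` T = {}" by blast
  show "is_LCD Y (fspace.span (e ` T))"
    using hull_span[OF T] unfolding is_LCD_def empty by simp
qed

lemma self_orthogonal_span:
  assumes T: "T \<subseteq> K"
  shows "self_orthogonal Y (fspace.span (e ` T)) \<longleftrightarrow> T \<inter> \<nu> ` T = {}"
proof
  assume so: "self_orthogonal Y (fspace.span (e ` T))"
  have "\<nu> k \<notin> T" if "k \<in> T" for k
  proof
    assume "\<nu> k \<in> T"
    then have "pairing Y (e k) (e (\<nu> k)) = 0"
      using so that by (auto simp: self_orthogonal_def dual_code_span fspace.span_base subset_iff)
    then show False using pairing_invol_nonzero that T by blast
  qed
  then show "T \<inter> \<nu> ` T = {}" by blast
next
  assume "T \<inter> \<nu> ` T = {}"
  then have "T - \<nu> ` T = T" by blast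
  then show "self_orthogonal Y (fspace.span (e ` T))"
    using hull_span[OF T] by (auto simp: self_orthogonal_def code_hull_def)
qed

end

section \<open>Roots of unity\<close>

lemma has_order_power_mod:
  assumes "has_order x k"
  shows "x ^ j = x ^ (j mod k)"
proof -
  have "x ^ j = (x ^ k) ^ (j div k) * x ^ (j mod k)"
    by (simp flip: power_mult power_add)
  then show ?thesis using assms by (simp add: has_order_def)
qed

lemma has_order_power_eq_1_iff:
  assumes "has_order x k"
  shows "x ^ j = 1 \<longleftrightarrow> k dvd j"
proof -
  have k: "0 < k" and least: "\<And>i. 0 < i \<Longrightarrow> i < k \<Longrightarrow> x ^ i \<noteq> 1"
    using assms by (auto simp: has_order_def)
  show ?thesis
    using least[of "j mod k"] k has_order_power_mod[OF assms, of j]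
    by (auto simp: dvd_eq_mod_eq_0)
qed

lemma has_order_nonzero: "has_order x k \<Longrightarrow> x \<noteq> 0"
  by (auto simp: has_order_def power_0_left split: if_splits)

lemma has_order_inj_on_power:
  assumes "has_order x k"
  shows "inj_on (\<lambda>i. x ^ i) {..<k}"
proof -
  have "i = j" if "i \<le> j" "j < k" "x ^ i = x ^ j" for i j
  proof -
    have "x ^ j = x ^ i * x ^ (j - i)" using that(1) by (simp flip: power_add)
    then have "x ^ (j - i) = 1" using that(3) has_order_nonzero[OF assms] by simp
    then have "k dvd j - i" using has_order_power_eq_1_iff[OF assms] by blast
    then show ?thesis using that nat_dvd_not_less[of "j - i" k] by linarith
  qed
  then show ?thesis
    by (intro inj_onI) (metis lessThan_iff nat_le_linear)
qed

text \<open>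
  In the field, \<open>q = 0\<close> and hence \<open>q - 1 = -1\<close>, so every divisor of \<open>q - 1\<close> is invertible.
  That \<open>q = 0\<close> is seen by translating the sum of all field elements by \<open>1\<close>.
\<close>

lemma of_nat_dvd_card_minus_1_nonzero:
  assumes "k dvd CARD('a::{field,finite}) - 1"
  shows "of_nat k \<noteq> (0 :: 'a)"
proof
  assume "of_nat k = (0 :: 'a)"
  then have 0: "of_nat (CARD('a) - 1) = (0 :: 'a)" using assms by (metis dvdE mult_zero_left of_nat_mult)
  have "(\<Sum>t\<in>UNIV. t + 1 :: 'a) = (\<Sum>t\<in>UNIV. t)"
    by (rule sum.reindex_bij_witness[of _ "\<lambda>t. t - 1" "\<lambda>t. t + 1"]) auto
  then have "of_nat CARD('a) = (0 :: 'a)" by (simp add: sum.distrib)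
  then have "of_nat (CARD('a) - 1) + 1 = (0 :: 'a)" by (simp add: of_nat_diff Suc_leI)
  with 0 show False by simp
qed

section \<open>The rational points as a regular orbit\<close>

text \<open>
  This extracts all that is needed from transitivity: an invariant set that contains one point
  contains all of them. Invariance under the two generators suffices, also for their inverses, since
  an injective map of a finite set into itself is onto.
\<close>

lemma transitive_invariant_superset:
  assumes z: "z \<noteq> 0" and l: "l \<noteq> 0" and tr: "acts_transitively z l Y"
    and Z: "finite Z" "tau z ` Z \<subseteq> Z" "sigma l ` Z \<subseteq> Z" and P: "P \<in> Y" "P \<in> Z"
  shows "Y \<subseteq> Z"
proof
  let ?B = "BijGroup (UNIV :: ('a \<times> 'a) set)"
  interpret B: group ?B by (rule group_BijGroup)
  have bij: "bij h" if "h \<in> {tau z, sigma l}" for h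
  proof -
    have "bij (tau z)"
      by (rule o_bij[of "tau (inverse z)"]) (auto simp: tau_def fun_eq_iff z)
    moreover have "bij (sigma l)"
      by (rule o_bij[of "sigma (inverse l)"]) (auto simp: sigma_def fun_eq_iff l)
    ultimately show ?thesis using that by blast
  qed
  have gens: "{tau z, sigma l} \<subseteq> carrier ?B"
    using bij by (auto simp: BijGroup_def Bij_def)
  have gen_Z: "h ` Z = Z" if "h \<in> {tau z, sigma l}" for h
    using that Z bij[OF that] endo_inj_surj[of Z h] by (auto intro: inj_on_subset[OF bij_is_inj])
  have Z_inv: "h ` Z = Z" if "h \<in> generate ?B {tau z, sigma l}" for h
    using that
  proof induction
    case one then show ?case by (simp add: BijGroup_def)
  next
    case (incl h) then show ?case by (rule gen_Z)
  next
    case (inv h)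
    then have "inv\<^bsub>?B\<^esub> h = inv_into UNIV h"
      using inv_BijGroup[of h UNIV] bij by (auto simp: Bij_def restrict_UNIV)
    then show ?case using gen_Z[OF inv] bij[OF inv] by (metis bij_is_inj image_inv_f_f)
  next
    case (eng h k)
    then have "h \<in> carrier ?B" "k \<in> carrier ?B"
      using B.generate_in_carrier[OF gens] by blast+
    then have "h \<otimes>\<^bsub>?B\<^esub> k = h \<circ> k"
      by (simp add: BijGroup_def compose_def fun_eq_iff)
    then show ?case using eng by (metis image_comp)
  qed
  fix Q assume Q: "Q \<in> Y"
  interpret transitive_action "Hgroup z l" Y "\<lambda>h. restrict h Y"
    using tr by (simp add: acts_transitively_def)
  obtain h where h: "h \<in> carrier (Hgroup z l)" "restrict h Y P = Q"
    using unique_orbit[OF P(1) Q] by blast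
  have "carrier (Hgroup z l) = generate ?B {tau z, sigma l}"
    using gens by (simp add: Hgroup_def subgroup_generated_def Int_absorb1)
  then show "Q \<in> Z" using h Z_inv[of h] P by auto
qed

text \<open>
  The exponents \<open>i\<close>, \<open>j\<close> range over all natural numbers here, which makes closure under the two
  generators immediate; the irredundant parametrisation is \<open>Y_eq_finite\<close>.
\<close>

locale regular_orbit =
  fixes Y :: "('a::{field,finite} \<times> 'a) set" and z l :: 'a and m n :: nat and x0 y0 :: 'a
  assumes order_l: "has_order l m" and order_z: "has_order z n"
    and m_dvd: "m dvd CARD('a) - 1" and n_dvd: "n dvd CARD('a) - 1"
    and x0: "x0 \<noteq> 0" and y0: "y0 \<noteq> 0"
    and Y_eq: "Y = (\<lambda>(i, j). (l ^ i * x0, z ^ j * y0)) ` UNIV"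
begin

lemma m_pos: "0 < m" and n_pos: "0 < n"
  using order_l order_z by (auto simp: has_order_def)

lemma fst_power: "P \<in> Y \<Longrightarrow> fst P ^ m = x0 ^ m"
  using order_l by (auto simp: Y_eq has_order_def power_mult_distrib simp flip: power_mult)
    (metis mult.commute power_mult power_one)

lemma snd_power: "P \<in> Y \<Longrightarrow> snd P ^ n = y0 ^ n"
  using order_z by (auto simp: Y_eq has_order_def power_mult_distrib simp flip: power_mult)
    (metis mult.commute power_mult power_one)

lemma tau_in: "P \<in> Y \<Longrightarrow> tau z P \<in> Y"
  unfolding Y_eq by (auto simp: tau_def image_iff simp flip: power_Suc mult.assoc)

lemma sigma_in: "P \<in> Y \<Longrightarrow> sigma l P \<in> Y"
  unfolding Y_eq by (auto simp: sigma_def image_iff simp flip: power_Suc mult.assoc)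

lemma Y_eq_finite: "Y = (\<lambda>(i, j). (l ^ i * x0, z ^ j * y0)) ` ({..<m} \<times> {..<n})"
proof (intro subset_antisym subsetI)
  fix P assume "P \<in> Y"
  then obtain i j where P: "P = (l ^ i * x0, z ^ j * y0)" by (auto simp: Y_eq)
  show "P \<in> (\<lambda>(i, j). (l ^ i * x0, z ^ j * y0)) ` ({..<m} \<times> {..<n})"
    using has_order_power_mod[OF order_l, of i] has_order_power_mod[OF order_z, of j] m_pos n_pos
    by (intro image_eqI[of _ _ "(i mod m, j mod n)"]) (auto simp: P)
qed (auto simp: Y_eq)

lemma card_Y: "card Y = m * n"
proof -
  have "inj_on (\<lambda>(i, j). (l ^ i * x0, z ^ j * y0)) ({..<m} \<times> {..<n})"
    using has_order_inj_on_power[OF order_l] has_order_inj_on_power[OF order_z] x0 y0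
    by (auto simp: inj_on_def)
  then show ?thesis by (simp add: Y_eq_finite card_image)
qed

text \<open>
  This is orthogonality of characters. The generators permute \<open>Y\<close> and multiply the summand by
  \<open>l ^ i\<close> and \<open>z ^ j\<close>, so the sum vanishes unless both factors are \<open>1\<close>. If they are, the summand is
  constant and the sum is that constant times \<open>m * n\<close>.
\<close>

lemma monomial_sum_eq_0_iff:
  "(\<Sum>P\<in>Y. fst P ^ i * snd P ^ j) = 0 \<longleftrightarrow> \<not> (m dvd i \<and> n dvd j)"
proof
  assume 0: "(\<Sum>P\<in>Y. fst P ^ i * snd P ^ j) = 0"
  show "\<not> (m dvd i \<and> n dvd j)"
  proof
    assume "m dvd i \<and> n dvd j"
    then obtain a b where ab: "i = m * a" "j = n * b" by (auto elim!: dvdE)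
    have "(\<Sum>P\<in>Y. fst P ^ i * snd P ^ j) = (\<Sum>P\<in>Y. (x0 ^ m) ^ a * (y0 ^ n) ^ b)"
      by (intro sum.cong) (simp_all add: ab power_mult fst_power snd_power)
    also have "\<dots> = of_nat m * of_nat n * ((x0 ^ m) ^ a * (y0 ^ n) ^ b)"
      by (simp add: card_Y)
    also have "\<dots> \<noteq> 0"
      using of_nat_dvd_card_minus_1_nonzero[OF m_dvd] of_nat_dvd_card_minus_1_nonzero[OF n_dvd] x0 y0
      by simp
    finally show False using 0 by simp
  qed
next
  assume nd: "\<not> (m dvd i \<and> n dvd j)"
  let ?F = "\<lambda>P :: 'a \<times> 'a. fst P ^ i * snd P ^ j"
  let ?S = "\<Sum>P\<in>Y. ?F P"
  have shift: "?S = c * ?S"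
    if h: "inj_on h Y" "h ` Y \<subseteq> Y" "\<And>P. ?F (h P) = c * ?F P" for h c
  proof -
    have "h ` Y = Y" using endo_inj_surj[of Y h] h by simp
    then have "?S = (\<Sum>P\<in>Y. ?F (h P))" using sum.reindex[OF h(1), of ?F] by simp
    then show ?thesis by (simp only: h(3) flip: sum_distrib_left)
  qed
  have "?S = l ^ i * ?S"
    using sigma_in has_order_nonzero[OF order_l]
    by (intro shift[of "sigma l"]) (auto simp: sigma_def inj_on_def power_mult_distrib)
  moreover have "?S = z ^ j * ?S"
    using tau_in has_order_nonzero[OF order_z]
    by (intro shift[of "tau z"]) (auto simp: tau_def inj_on_def power_mult_distrib)
  ultimately show "?S = 0"
    using nd has_order_power_eq_1_iff[OF order_l] has_order_power_eq_1_iff[OF order_z]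
    by (auto simp: mult_cancel_right1)
qed

definition chars :: "(int \<times> int) set" where
  "chars = {0..<int m} \<times> {0..<int n}"

definition char_neg :: "int \<times> int \<Rightarrow> int \<times> int" where
  "char_neg = (\<lambda>(a, b). ((- a) mod int m, (- b) mod int n))"

text \<open>
  On \<open>Y\<close> this is the character of the orbit up to the scalar \<open>x0 ^ a * y0 ^ b\<close>. Using the monomial
  itself instead of the normalised character avoids a parametrisation of the points.
\<close>

definition char_vec :: "int \<times> int \<Rightarrow> 'a \<times> 'a \<Rightarrow> 'a" where
  "char_vec = (\<lambda>(a, b). eval_vec Y (nat a, nat b))"

lemma neg_mod_eq_iff:
  assumes "a \<in> {0..<int k}" "b \<in> {0..<int k}"
  shows "b = (- a) mod int k \<longleftrightarrow> k dvd nat a + nat b"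
proof -
  have "b = (- a) mod int k \<longleftrightarrow> b mod int k = (- a) mod int k" using assms by simp
  also have "\<dots> \<longleftrightarrow> int k dvd b + a" by (simp add: mod_eq_dvd_iff)
  also have "\<dots> \<longleftrightarrow> int k dvd int (nat a + nat b)" using assms by (simp add: add.commute)
  finally show ?thesis by (simp only: int_dvd_int_iff)
qed

sublocale paired_family Y chars char_neg char_vec
proof
  show "finite chars" by (simp add: chars_def)
  fix k assume k: "k \<in> chars"
  show "char_vec k \<in> ambient Y" by (auto simp: char_vec_def eval_vec_def ambient_def split_def)
  show "char_neg k \<in> chars" using k m_pos n_pos by (auto simp: chars_def char_neg_def)
  show "char_neg (char_neg k) = k" using k by (auto simp: chars_def char_neg_def mod_minus_eq)
  fix k' assume k': "k' \<in> chars"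
  obtain a b a' b' where ab: "k = (a, b)" "k' = (a', b')" by (cases k, cases k')
  have "pairing Y (char_vec k) (char_vec k')
      = (\<Sum>P\<in>Y. fst P ^ (nat a + nat a') * snd P ^ (nat b + nat b'))"
    unfolding pairing_def
    by (intro sum.cong) (auto simp: ab char_vec_def eval_vec_def power_add)
  then show "pairing Y (char_vec k) (char_vec k') = 0 \<longleftrightarrow> k' \<noteq> char_neg k"
    using k k' neg_mod_eq_iff[of a m a'] neg_mod_eq_iff[of b n b']
    by (auto simp: monomial_sum_eq_0_iff ab chars_def char_neg_def)
qed

text \<open>
  A joint eigenvector is determined by its value at \<open>(x0, y0)\<close>, because the group reaches
  every other point from there.
\<close>

lemma eigenline_eq:
  assumes k: "k \<in> chars"
  shows "eigenline Y z l k = range (\<lambda>c. vscale c (char_vec k))"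
proof -
  obtain a b where ab: "k = (int a, int b)"
    using k by (auto simp: chars_def elim!: nonneg_int_cases)
  have vec: "char_vec k = (\<lambda>P. if P \<in> Y then fst P ^ a * snd P ^ b else 0)"
    by (auto simp: char_vec_def ab eval_vec_def)
  show ?thesis
  proof (intro subset_antisym subsetI)
    fix v assume "v \<in> eigenline Y z l k"
    then have amb: "v \<in> ambient Y"
      and s: "\<And>P. P \<in> Y \<Longrightarrow> v (sigma l P) = l ^ a * v P"
      and t: "\<And>P. P \<in> Y \<Longrightarrow> v (tau z P) = z ^ b * v P"
      by (auto simp: eigenline_def ab)
    have v_x: "v (l ^ i * x0, y0) = l ^ (a * i) * v (x0, y0)" for i
    proof (induction i)
      case (Suc i)
      have "(l ^ i * x0, y0) \<in> Y" unfolding Y_eq by (rule image_eqI[of _ _ "(i, 0)"]) auto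
      from s[OF this] show ?case by (simp add: sigma_def Suc power_add mult.assoc)
    qed simp
    have v_xy: "v (l ^ i * x0, z ^ j * y0) = z ^ (b * j) * v (l ^ i * x0, y0)" for i j
    proof (induction j)
      case (Suc j)
      have "(l ^ i * x0, z ^ j * y0) \<in> Y" unfolding Y_eq by auto
      from t[OF this] show ?case by (simp add: tau_def Suc power_add mult.assoc)
    qed simp
    have "v = vscale (v (x0, y0) / (x0 ^ a * y0 ^ b)) (char_vec k)"
    proof
      fix P
      show "v P = vscale (v (x0, y0) / (x0 ^ a * y0 ^ b)) (char_vec k) P"
      proof (cases "P \<in> Y")
        case True
        then obtain i j where "P = (l ^ i * x0, z ^ j * y0)" by (auto simp: Y_eq)
        then show ?thesis
          using True x0 y0 v_xy v_x
          by (simp add: vscale_def vec power_mult_distrib power_mult mult_ac flip: power_mult)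
      next
        case False
        then have "v P = 0" using amb unfolding ambient_def by blast
        then show ?thesis using False by (simp add: vscale_def vec)
      qed
    qed
    then show "v \<in> range (\<lambda>c. vscale c (char_vec k))" by blast
  next
    fix v assume "v \<in> range (\<lambda>c. vscale c (char_vec k))"
    then obtain c where "v = vscale c (\<lambda>P. if P \<in> Y then fst P ^ a * snd P ^ b else 0)"
      unfolding vec by blast
    then show "v \<in> eigenline Y z l k"
      using tau_in sigma_in
      by (auto simp: eigenline_def ab vscale_def ambient_def tau_def sigma_def power_mult_distrib)
  qed
qed

text \<open>
  The factors \<open>x ^ m\<close> and \<open>y ^ n\<close> split off as constants, since \<open>l ^ m = 1\<close> and \<open>z ^ n = 1\<close> make
  them the same at all points.
\<close>

lemma eval_vec_reduce:
  "eval_vec Y (i, j) = vscale ((x0 ^ m) ^ (i div m) * (y0 ^ n) ^ (j div n))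
     (char_vec (int i mod int m, int j mod int n))"
proof
  fix P
  show "eval_vec Y (i, j) P = vscale ((x0 ^ m) ^ (i div m) * (y0 ^ n) ^ (j div n))
     (char_vec (int i mod int m, int j mod int n)) P"
  proof (cases "P \<in> Y")
    case True
    have "fst P ^ i = (fst P ^ m) ^ (i div m) * fst P ^ (i mod m)"
      and "snd P ^ j = (snd P ^ n) ^ (j div n) * snd P ^ (j mod n)"
      by (simp_all flip: power_mult power_add)
    then show ?thesis
      using True by (simp add: vscale_def char_vec_def eval_vec_def fst_power snd_power mult_ac
          nat_mod_distrib)
  next
    case False
    then show ?thesis by (simp add: vscale_def char_vec_def eval_vec_def)
  qed
qed

lemma span_eval_vec:
  "fspace.span (eval_vec Y ` B)
     = fspace.span (char_vec ` (\<lambda>(i, j). (int i mod int m, int j mod int n)) ` B)"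
    (is "?L = fspace.span (char_vec ` ?r ` B)")
proof (intro subset_antisym fspace.span_minimal fspace.subspace_span subsetI)
  fix v assume "v \<in> eval_vec Y ` B"
  then obtain i j where "(i, j) \<in> B" "v = eval_vec Y (i, j)" by auto
  then show "v \<in> fspace.span (char_vec ` ?r ` B)"
    unfolding \<open>v = _\<close> eval_vec_reduce
    by (intro fspace.span_scale fspace.span_base imageI image_eqI[of _ ?r "(i, j)"]) auto
next
  fix v assume "v \<in> char_vec ` ?r ` B"
  then obtain i j where ij: "(i, j) \<in> B" "v = char_vec (int i mod int m, int j mod int n)" by auto
  let ?c = "(x0 ^ m) ^ (i div m) * (y0 ^ n) ^ (j div n)"
  have "?c \<noteq> 0" using x0 y0 by simp
  from left_inverse[OF this] have "v = vscale (inverse ?c) (eval_vec Y (i, j))"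
    unfolding eval_vec_reduce ij(2) fspace.scale_scale by (simp only: fspace.scale_one)
  then show "v \<in> ?L"
    using ij(1) by (simp only: fspace.span_scale fspace.span_base imageI)
qed

lemma neg_set_eq_image:
  assumes "T \<subseteq> chars"
  shows "neg_set m n T = char_neg ` T"
proof -
  have "carrier (char_group m n) = chars"
    using m_pos n_pos by (simp add: char_group_def chars_def carrier_integer_mod_group)
  then show ?thesis
    using neg_set_eq[OF m_pos n_pos, of T] assms by (force simp: char_neg_def)
qed

end

lemma regular_orbit_if_transitive:
  assumes l: "has_order l m" and z: "has_order z n"
    and mq: "m dvd CARD('a::{field,finite}) - 1" and nq: "n dvd CARD('a) - 1"
    and act: "\<And>P. P \<in> Y \<Longrightarrow> tau z P \<in> Y" "\<And>P. P \<in> Y \<Longrightarrow> sigma l P \<in> Y"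
    and tr: "acts_transitively z l Y"
    and P: "(x0, y0) \<in> Y" and x0: "x0 \<noteq> 0" and y0: "y0 \<noteq> (0 :: 'a)"
  shows "regular_orbit Y z l m n x0 y0"
proof
  let ?Z = "(\<lambda>(i, j). (l ^ i * x0, z ^ j * y0)) ` UNIV"
  show "Y = ?Z"
  proof
    have "tau z ` ?Z \<subseteq> ?Z"
      by (auto simp: tau_def image_iff simp flip: power_Suc mult.assoc)
    moreover have "sigma l ` ?Z \<subseteq> ?Z"
      by (auto simp: sigma_def image_iff simp flip: power_Suc mult.assoc)
    moreover have "(x0, y0) \<in> ?Z" by (rule image_eqI[of _ _ "(0, 0)"]) auto
    ultimately show "Y \<subseteq> ?Z"
      using transitive_invariant_superset[OF has_order_nonzero[OF z] has_order_nonzero[OF l] tr _ _ _ P]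
      by simp
  next
    have "(l ^ i * x0, z ^ j * y0) \<in> Y" for i j
    proof (induction i)
      case 0
      show ?case
      proof (induction j)
        case (Suc j)
        then show ?case using act(1) by (force simp: tau_def mult.assoc)
      qed (use P in simp)
    next
      case (Suc i)
      then show ?case using act(2) by (force simp: sigma_def mult.assoc)
    qed
    then show "?Z \<subseteq> Y" by auto
  qed
qed (use assms in auto)

section \<open>The hull\<close>

theorem theorem5p8:
  fixes f g :: "'a::{field,finite} poly"
    and n d m s :: nat
    and lam zeta :: 'a
  defines "Y \<equiv> finite_points n f"
  defines "C \<equiv> AG_code n f s"
  defines "T \<equiv> defining_set m n d s"
  assumes "n \<ge> 2" and "d \<ge> 3" and "n dvd CARD('a) - 1"
    and "degree f = d" and "separable f" and "\<And>x. poly f x \<noteq> 0"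
    and "m > 0" and "m dvd exponent_gcd f"
    and "has_order lam m" and "has_order zeta n"
    and "f = pcompose g (monom 1 m)" and "degree g = d div m"
    and "poly g 0 \<notin> {t ^ n | t. t \<noteq> 0}"
    and "acts_transitively zeta lam Y"
    and "s \<ge> 1"
  shows "internal_direct_sum (code_hull Y C) (T - neg_set m n T) (eigenline Y zeta lam)
       \<and> int (fspace.dim (code_hull Y C)) = int (card T) - int (card (T \<inter> neg_set m n T))
       \<and> (is_LCD Y C \<longleftrightarrow> T = neg_set m n T)
       \<and> (self_orthogonal Y C \<longleftrightarrow> T \<inter> neg_set m n T = {})"
proof -
  obtain x0 y0 where P: "(x0, y0) \<in> Y"
    using assms(17) by (auto simp: acts_transitively_def)
  then have curve: "y0 ^ n = poly f x0" by (simp add: Y_def finite_points_def)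
  have y0: "y0 \<noteq> 0"
    using curve assms(4,9) by (metis not_numeral_le_zero power_0_left)
  have x0: "x0 \<noteq> 0"
  proof
    assume "x0 = 0"
    then have "poly g 0 = y0 ^ n"
      using curve \<open>m > 0\<close> by (simp add: assms(14) poly_pcompose poly_monom power_0_left)
    then show False using assms(16) y0 by blast
  qed
  have mq: "m dvd CARD('a) - 1"
    using assms(11) by (simp add: exponent_gcd_def)
  have act: "tau zeta P \<in> Y" "sigma lam P \<in> Y" if "P \<in> Y" for P
    using that assms(12,13)
    by (auto simp: Y_def finite_points_def tau_def sigma_def assms(14) has_order_def
        power_mult_distrib poly_pcompose poly_monom)
  interpret regular_orbit Y zeta lam m n x0 y0
    using regular_orbit_if_transitive[OF assms(12,13) mq assms(6) act assms(17) P x0 y0] .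
  have T: "T \<subseteq> chars"
    using m_pos n_pos by (auto simp: T_def defining_set_def chars_def)
  have C: "C = fspace.span (char_vec ` T)"
    using span_eval_vec by (simp add: C_def AG_code_def T_def defining_set_def Y_def assms(7))
  have "internal_direct_sum (code_hull Y C) (T - char_neg ` T) (eigenline Y zeta lam)"
    unfolding C hull_span[OF T] using T eigenline_eq by (intro direct_sum_lines) blast+
  then show ?thesis
    using dim_hull[OF T] is_LCD_span[OF T] self_orthogonal_span[OF T]
    by (simp add: C neg_set_eq_image[OF T])
qed

end
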